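(* Let $\alpha>0$, $x_\circ\in\mathbb R^n$, and let $(\mathcal A_{\sigma_i},B)_{i=1}^N$ be ensemble stabilizable. For a given parameter $\sigma\in\mathbb R$, assume $$\|\mathbf A_\sigma-\mathbf A_\varSigma\|<\frac{\beta_1}{2N\beta_2^3}.$$ Then the closed-loop system $$\dot x_{\varSigma,\sigma}=\mathcal A_\sigma x_{\varSigma,\sigma}-\tfrac1\alpha B\mathbf B^\top\mathbf\Pi_\varSigma\mathcal E x_{\varSigma,\sigma},\qquad x_{\varSigma,\sigma}(0)=x_\circ,$$ obtained with the feedback $-\frac1\alpha\mathbf B^\top\mathbf\Pi_\varSigma\mathcal E$, is stable. More precisely, for $t\ge0$, $$\|\mathcal E x_{\varSigma,\sigma}(t)\|^2_{\mathbf\Pi_\varSigma}\le e^{-\lambda t}\|\mathcal E x_{\varSigma,\sigma}(0)\|^2_{\mathbf\Pi_\varSigma},\qquad \|x_{\varSigma,\sigma}(t)\|^2\le\Bigl(\frac{\beta_2}{\beta_1}\Bigr)^2e^{-\lambda t}\|x_{\varSigma,\sigma}(0)\|^2,$$ with $$\lambda=\frac1{N\beta_2^2}-\frac{2\beta_2}{\beta_1}\|\mathbf A_\sigma-\mathbf A_\varSigma\|>0 .$$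
   Context: Setting: $N\ge2$, $\varSigma=(\sigma_i)_{i=1}^N$ a finite ensemble of parameters; to each parameter $\sigma\in\mathbb R$ is associated a matrix $\mathcal A_\sigma\in\mathbb R^{n\times n}$; $B\in\mathbb R^{n\times m}$. $\mathbf A_\varSigma\in\mathbb R^{nN\times nN}$ is block-diagonal with blocks $\mathcal A_{\sigma_1},\ldots,\mathcal A_{\sigma_N}$; $\mathbf A_\sigma\in\mathbb R^{nN\times nN}$ is block-diagonal with $N$ identical blocks $\mathcal A_\sigma$; $\mathbf B\in\mathbb R^{nN\times m}$ is the stack of $N$ copies of $B$; $\mathcal E:\mathbb R^n\to\mathbb R^{nN}$, $\mathcal E x=\begin{bmatrix}x^\top&\cdots&x^\top\end{bmatrix}^\top$ ($N$ copies). Vector norms are Euclidean, matrix norms are the induced operator norms. A matrix is stable if all its eigenvalues have negative real part; a linear system $\dot x=Gx$ is stable if $G$ is. $(\mathcal A_{\sigma_i},B)_{i=1}^N$ is ensemble stabilizable if there is $\mathbf K\in\mathbb R^{m\times nN}$ with $\mathbf A_\varSigma+\mathbf B\mathbf K$ stable. $\mathbf\Pi_\varSigma$ is the unique positive definite (symmetric) solution of $\mathbf A_\varSigma^\top\mathbf\Pi_\varSigma+\mathbf\Pi_\varSigma\mathbf A_\varSigma-\frac1\alpha\mathbf\Pi_\varSigma\mathbf B\mathbf B^\top\mathbf\Pi_\varSigma+\frac1N\mathbf 1_{nN}=0$, where $\mathbf 1_{nN}$ is the identity matrix. With $\|\mathbf y\|_{\mathbf\Pi_\varSigma}=\sqrt{\langle\mathbf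 y,\mathbf\Pi_\varSigma\mathbf y\rangle}$, $\beta_1,\beta_2>0$ are constants such that $\beta_1\|\mathbf y\|\le\|\mathbf y\|_{\mathbf\Pi_\varSigma}\le\beta_2\|\mathbf y\|$ for all $\mathbf y\in\mathbb R^{nN}$. *)

theory Defs
  imports "HOL-Analysis.Analysis"
begin

text \<open>
  Vectors of length $nN$ are indexed by the product type \<open>'N \<times> 'n\<close>: the index \<open>(i, a)\<close> is the
  component \<open>a\<close> of the \<open>i\<close>-th block. A real matrix with \<open>r\<close> rows and \<open>c\<close> columns has type
  \<open>real ^ 'c ^ 'r\<close>.
\<close>

definition eigenvalue :: "complex ^ 'k ^ 'k \<Rightarrow> complex \<Rightarrow> bool" where
  "eigenvalue M \<mu> \<longleftrightarrow> (\<exists>v. v \<noteq> 0 \<and> M *v v = \<mu> *s v)"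

definition stable_matrix :: "real ^ 'k ^ 'k \<Rightarrow> bool" where
  "stable_matrix G \<longleftrightarrow> (\<forall>\<mu>. eigenvalue (map_matrix complex_of_real G) \<mu> \<longrightarrow> Re \<mu> < 0)"

text \<open>
  The induced Euclidean operator norm; the type class \<open>norm\<close> on \<open>real ^ 'c ^ 'r\<close> is the Frobenius
  norm instead.
\<close>

definition matrix_opnorm :: "real ^ 'c ^ 'r \<Rightarrow> real" where
  "matrix_opnorm M = onorm (\<lambda>v. M *v v)"

definition block_diag :: "('N::finite \<Rightarrow> real ^ 'n ^ 'n) \<Rightarrow> real ^ ('N \<times> 'n) ^ ('N \<times> 'n)" where
  "block_diag D = (\<chi> p q. if fst p = fst q then D (fst p) $ snd p $ snd q else 0)"

definition stack_matrix :: "real ^ 'm ^ 'n \<Rightarrow> real ^ 'm ^ ('N::finite \<times> 'n)" where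
  "stack_matrix B = (\<chi> p. B $ snd p)"

definition stack_vec :: "real ^ 'n \<Rightarrow> real ^ ('N::finite \<times> 'n)" where
  "stack_vec x = (\<chi> p. x $ snd p)"

definition ensemble_stabilizable :: "('N::finite \<Rightarrow> real ^ 'n ^ 'n) \<Rightarrow> real ^ 'm ^ 'n \<Rightarrow> bool" where
  "ensemble_stabilizable D B \<longleftrightarrow>
     (\<exists>K :: real ^ ('N \<times> 'n) ^ 'm. stable_matrix (block_diag D + stack_matrix B ** K))"

definition pos_def :: "real ^ 'k ^ 'k \<Rightarrow> bool" where
  "pos_def P \<longleftrightarrow> transpose P = P \<and> (\<forall>y. y \<noteq> 0 \<longrightarrow> 0 < y \<bullet> (P *v y))"

definition riccati_solution ::
    "real \<Rightarrow> ('N::finite \<Rightarrow> real ^ 'n ^ 'n) \<Rightarrow> real ^ 'm ^ 'n \<Rightarrow> real ^ ('N \<times> 'n) ^ ('N \<times> 'n) \<Rightarrow> bool" where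
  "riccati_solution \<alpha> D B P \<longleftrightarrow>
     transpose (block_diag D) ** P + P ** block_diag D
     - (1 / \<alpha>) *\<^sub>R (P ** stack_matrix B ** transpose (stack_matrix B) ** P)
     + (1 / real CARD('N)) *\<^sub>R mat 1 = 0"

definition weighted_norm :: "real ^ 'k ^ 'k \<Rightarrow> real ^ 'k \<Rightarrow> real" where
  "weighted_norm P y = sqrt (y \<bullet> (P *v y))"

definition closed_loop_matrix ::
    "real \<Rightarrow> real ^ 'n ^ 'n \<Rightarrow> real ^ 'm ^ 'n \<Rightarrow> real ^ ('N::finite \<times> 'n) ^ ('N \<times> 'n) \<Rightarrow> real ^ 'n ^ 'n" where
  "closed_loop_matrix \<alpha> A B P =
     A - (1 / \<alpha>) *\<^sub>R (B ** transpose (stack_matrix B :: real ^ 'm ^ ('N \<times> 'n)) ** P ** matrix stack_vec)"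

end

theory Submission
  imports Defs
begin

text \<open>
  The stacking map intertwines the closed loop \<open>G\<close> with \<open>F = \<^bold>A\<^sub>\<Sigma> + \<Delta> - \<alpha>\<^sup>-\<^sup>1 \<^bold>B \<^bold>B\<^sup>T P\<close>, where
  \<open>\<Delta> = \<^bold>A\<^sub>\<sigma> - \<^bold>A\<^sub>\<Sigma>\<close>. By the Riccati equation,
  \<open>2 \<langle>y, P F y\<rangle> = - \<alpha>\<^sup>-\<^sup>1 \<parallel>\<^bold>B\<^sup>T P y\<parallel>\<^sup>2 - N\<^sup>-\<^sup>1 \<parallel>y\<parallel>\<^sup>2 + 2 \<langle>y, P \<Delta> y\<rangle>\<close>, and the Cauchy--Schwarz inequality
  for the weighted norm bounds this by \<open>- \<lambda> \<langle>y, P y\<rangle>\<close>. So \<open>\<langle>y, P y\<rangle>\<close> is a Lyapunov function for \<open>G\<close>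
  with rate \<open>\<lambda>\<close>. This yields the exponential estimate for the trajectories and, summed over the real and
  imaginary parts of an eigenvector, a negative bound on the real part of every eigenvalue.
\<close>

section \<open>The inner product weighted by a positive definite matrix\<close>

lemma pos_def_inner_commute:
  fixes P :: "real ^ 'k ^ 'k"
  assumes "pos_def P"
  shows "x \<bullet> (P *v y) = y \<bullet> (P *v x)"
proof -
  have "x \<bullet> (P *v y) = (transpose P *v x) \<bullet> y"
    by (metis dot_lmul_matrix transpose_matrix_vector)
  then show ?thesis
    using assms by (simp add: pos_def_def inner_commute del: transpose_matrix_vector)
qed

lemma pos_def_nonneg:
  fixes P :: "real ^ 'k ^ 'k"
  assumes "pos_def P"
  shows "0 \<le> y \<bullet> (P *v y)"
  using assms by (cases "y = 0") (auto simp: pos_def_def less_imp_le)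

lemma weighted_norm_power2:
  fixes P :: "real ^ 'k ^ 'k"
  assumes "pos_def P"
  shows "(weighted_norm P y)\<^sup>2 = y \<bullet> (P *v y)"
  using pos_def_nonneg[OF assms] by (simp add: weighted_norm_def)

lemma weighted_norm_Cauchy_Schwarz:
  fixes P :: "real ^ 'k ^ 'k"
  assumes "pos_def P"
  shows "x \<bullet> (P *v y) \<le> weighted_norm P x * weighted_norm P y"
proof (cases "y = 0")
  case True
  then show ?thesis by (simp add: weighted_norm_def)
next
  case False
  define p c q where "p = x \<bullet> (P *v x)" and "c = x \<bullet> (P *v y)" and "q = y \<bullet> (P *v y)"
  have "q > 0"
    using assms False by (simp add: pos_def_def q_def)
  \<comment> \<open>Up to the factor \<open>q\<close>, this vector is the part of \<open>x\<close>
    that is \<open>P\<close>-orthogonal to \<open>y\<close>. Scaling by \<open>q\<close> keeps the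
    computation free of division.\<close>
  have "0 \<le> (q *\<^sub>R x - c *\<^sub>R y) \<bullet> (P *v (q *\<^sub>R x - c *\<^sub>R y))"
    by (rule pos_def_nonneg[OF assms])
  also have "\<dots> = q * (p * q - c\<^sup>2)"
    using pos_def_inner_commute[OF assms, of y x]
    by (simp add: p_def c_def q_def matrix_vector_mult_diff_distrib matrix_vector_mult_scaleR
        inner_diff_left inner_diff_right algebra_simps power2_eq_square)
  finally have "c\<^sup>2 \<le> p * q"
    using \<open>q > 0\<close> by (simp add: zero_le_mult_iff)
  then have "c \<le> sqrt (p * q)"
    by (rule real_le_rsqrt)
  then show ?thesis
    by (simp add: p_def c_def q_def weighted_norm_def real_sqrt_mult)
qed

section \<open>Operator norm bounds and dissipation from the Riccati equation\<close>

lemma norm_matrix_vector_le_opnorm: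
  fixes M :: "real ^ 'c ^ 'r"
  shows "norm (M *v y) \<le> matrix_opnorm M * norm y"
  unfolding matrix_opnorm_def by (rule onorm) simp

lemma matrix_opnorm_nonneg:
  fixes M :: "real ^ 'c ^ 'r"
  shows "0 \<le> matrix_opnorm M"
  unfolding matrix_opnorm_def by (rule onorm_pos_le) simp

text \<open>The argument uses no block structure, so \<open>S\<close>, \<open>C\<close> and
  \<open>c\<close> are general. The ensemble enters later with \<open>c\<close> equal to 1/N and
  \<open>C\<close> the stacked input matrix.\<close>

lemma riccati_dissipation:
  fixes S :: "real ^ 'k ^ 'k" and C :: "real ^ 'm ^ 'k" and P \<Delta> :: "real ^ 'k ^ 'k"
  assumes "pos_def P" and "\<alpha> > 0" and "c \<ge> 0"
    and riccati: "transpose S ** P + P ** S - (1 / \<alpha>) *\<^sub>R (P ** C ** transpose C ** P) + c *\<^sub>R mat 1 = 0"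
    and "b\<^sub>1 > 0" and "b\<^sub>2 > 0"
    and lower: "\<And>y. b\<^sub>1 * norm y \<le> weighted_norm P y"
    and upper: "\<And>y. weighted_norm P y \<le> b\<^sub>2 * norm y"
  shows "2 * (y \<bullet> (P *v ((S + \<Delta> - (1 / \<alpha>) *\<^sub>R (C ** transpose C ** P)) *v y)))
    \<le> - (c / b\<^sub>2\<^sup>2 - 2 * b\<^sub>2 / b\<^sub>1 * matrix_opnorm \<Delta>) * (weighted_norm P y)\<^sup>2"
proof -
  define w where "w = weighted_norm P y"
  define u where "u = transpose C *v (P *v y)"
  have w0: "0 \<le> w"
    using \<open>b\<^sub>1 > 0\<close> order_trans[OF _ lower[of y]] by (simp add: w_def)
  have quad: "y \<bullet> (P *v (C *v u)) = u \<bullet> u"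
  proof -
    have "y \<bullet> (P *v (C *v u)) = (C *v u) \<bullet> (P *v y)"
      by (rule pos_def_inner_commute[OF \<open>pos_def P\<close>])
    also have "\<dots> = u \<bullet> (transpose C *v (P *v y))"
      by (metis dot_lmul_matrix inner_commute transpose_matrix_vector)
    finally show ?thesis by (simp add: u_def)
  qed
  have symm: "y \<bullet> (transpose S *v (P *v y)) = y \<bullet> (P *v (S *v y))"
    by (metis dot_lmul_matrix inner_commute pos_def_inner_commute[OF \<open>pos_def P\<close>]
        transpose_matrix_vector)
  have "0 = y \<bullet> ((transpose S ** P + P ** S - (1 / \<alpha>) *\<^sub>R (P ** C ** transpose C ** P)
      + c *\<^sub>R mat 1) *v y)"
    by (simp add: riccati)
  also have "\<dots> = 2 * (y \<bullet> (P *v (S *v y))) - (1 / \<alpha>) * (u \<bullet> u) + c * (norm y)\<^sup>2"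
    by (simp add: matrix_vector_mult_add_rdistrib matrix_vector_mult_diff_rdistrib
        scaleR_matrix_vector_assoc[symmetric] matrix_vector_mul_assoc[symmetric]
        inner_add_right inner_diff_right symm quad[unfolded u_def] u_def power2_norm_eq_inner
        del: transpose_matrix_vector)
  finally have lyapunov: "2 * (y \<bullet> (P *v (S *v y))) = (1 / \<alpha>) * (u \<bullet> u) - c * (norm y)\<^sup>2"
    by simp
  have "2 * (y \<bullet> (P *v ((S + \<Delta> - (1 / \<alpha>) *\<^sub>R (C ** transpose C ** P)) *v y)))
      = 2 * (y \<bullet> (P *v (S *v y))) + 2 * (y \<bullet> (P *v (\<Delta> *v y))) - 2 * ((1 / \<alpha>) * (u \<bullet> u))"
    by (simp add: matrix_vector_mult_add_rdistrib matrix_vector_mult_diff_rdistrib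
        matrix_vector_right_distrib matrix_vector_mult_diff_distrib matrix_vector_mult_scaleR
        scaleR_matrix_vector_assoc[symmetric] matrix_vector_mul_assoc[symmetric]
        inner_add_right inner_diff_right quad[unfolded u_def] u_def
        del: transpose_matrix_vector)
  \<comment> \<open>The feedback contributes the quadratic term in \<open>u\<close> twice with a
    negative sign, and the Riccati equation returns it once. The negative copy left over is dropped
    in the next step.\<close>
  also have "\<dots> = - (1 / \<alpha>) * (u \<bullet> u) - c * (norm y)\<^sup>2 + 2 * (y \<bullet> (P *v (\<Delta> *v y)))"
    by (simp add: lyapunov)
  also have "\<dots> \<le> - c * (norm y)\<^sup>2 + 2 * (y \<bullet> (P *v (\<Delta> *v y)))"
    using \<open>\<alpha> > 0\<close> by simp
  \<comment> \<open>Both terms are now measured by \<open>w\<close>. The upper norm bound weakens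
    the decay by the square of \<open>b\<^sub>2\<close>. The perturbation costs
    \<open>b\<^sub>2\<close> for passing from the weighted norm of \<open>\<Delta> *v y\<close> to
    the Euclidean one, and \<open>1 / b\<^sub>1\<close> for passing from \<open>norm y\<close> back
    to \<open>w\<close>.\<close>
  also have "\<dots> \<le> - c * (w\<^sup>2 / b\<^sub>2\<^sup>2) + 2 * (b\<^sub>2 / b\<^sub>1 * matrix_opnorm \<Delta> * w\<^sup>2)"
  proof -
    have "w\<^sup>2 \<le> b\<^sub>2\<^sup>2 * (norm y)\<^sup>2"
      using power_mono[OF upper[of y] w0[unfolded w_def], of 2] by (simp add: w_def power_mult_distrib)
    then have "w\<^sup>2 / b\<^sub>2\<^sup>2 \<le> (norm y)\<^sup>2"
      using \<open>b\<^sub>2 > 0\<close> by (simp add: divide_le_eq mult.commute)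
    then have decay: "c * (w\<^sup>2 / b\<^sub>2\<^sup>2) \<le> c * (norm y)\<^sup>2"
      using \<open>c \<ge> 0\<close> by (rule mult_left_mono)
    have "norm y \<le> w / b\<^sub>1"
      using lower[of y] \<open>b\<^sub>1 > 0\<close> by (simp add: w_def le_divide_eq mult.commute)
    have "y \<bullet> (P *v (\<Delta> *v y)) \<le> w * weighted_norm P (\<Delta> *v y)"
      unfolding w_def by (rule weighted_norm_Cauchy_Schwarz[OF \<open>pos_def P\<close>])
    also have "\<dots> \<le> w * (b\<^sub>2 * norm (\<Delta> *v y))"
      by (intro mult_left_mono upper w0)
    also have "\<dots> \<le> w * (b\<^sub>2 * (matrix_opnorm \<Delta> * norm y))"
      using \<open>b\<^sub>2 > 0\<close> by (intro mult_left_mono norm_matrix_vector_le_opnorm w0) simp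
    also have "\<dots> \<le> w * (b\<^sub>2 * (matrix_opnorm \<Delta> * (w / b\<^sub>1)))"
      using \<open>b\<^sub>2 > 0\<close> by (intro mult_left_mono \<open>norm y \<le> w / b\<^sub>1\<close> w0 matrix_opnorm_nonneg) simp
    also have "\<dots> = b\<^sub>2 / b\<^sub>1 * matrix_opnorm \<Delta> * w\<^sup>2"
      by (simp add: power2_eq_square)
    finally show ?thesis using decay by simp
  qed
  also have "\<dots> = - (c / b\<^sub>2\<^sup>2 - 2 * b\<^sub>2 / b\<^sub>1 * matrix_opnorm \<Delta>) * w\<^sup>2"
    by (simp add: algebra_simps)
  finally show ?thesis by (simp add: w_def)
qed

section \<open>The stacking map and the closed loop\<close>

lemma sum_UNIV_prod:
  fixes f :: "'a::finite \<times> 'b::finite \<Rightarrow> 'c::comm_monoid_add"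
  shows "(\<Sum>p\<in>UNIV. f p) = (\<Sum>i\<in>UNIV. \<Sum>a\<in>UNIV. f (i, a))"
  by (simp add: sum.cartesian_product)

lemma linear_stack_vec: "linear (stack_vec :: real ^ 'n \<Rightarrow> real ^ ('N::finite \<times> 'n))"
  by (rule linearI) (simp_all add: stack_vec_def vec_eq_iff)

lemma norm_stack_vec:
  fixes x :: "real ^ 'n"
  shows "(norm (stack_vec x :: real ^ ('N::finite \<times> 'n)))\<^sup>2 = real CARD('N) * (norm x)\<^sup>2"
  by (simp add: power2_norm_eq_inner inner_vec_def stack_vec_def sum_UNIV_prod)

lemma block_diag_mult_stack_vec:
  fixes M :: "real ^ 'n ^ 'n"
  shows "block_diag (\<lambda>_::'N::finite. M) *v stack_vec x = stack_vec (M *v x)"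
proof -
  \<comment> \<open>Once the block test is outside the inner sum, the sum over blocks collapses to
    its diagonal term.\<close>
  have *: "(\<Sum>a\<in>UNIV. (if i = j then M $ k $ a else 0) * x $ a)
      = (if i = j then (\<Sum>a\<in>UNIV. M $ k $ a * x $ a) else 0)" for i j :: 'N and k
    by simp
  show ?thesis
    by (simp add: vec_eq_iff matrix_vector_mult_def block_diag_def stack_vec_def sum_UNIV_prod * cong: if_cong)
qed

lemma stack_matrix_mult:
  fixes B :: "real ^ 'm ^ 'n"
  shows "stack_matrix B *v u = (stack_vec (B *v u) :: real ^ ('N::finite \<times> 'n))"
  by (simp add: vec_eq_iff matrix_vector_mult_def stack_matrix_def stack_vec_def)

text \<open>All diagonal blocks are the same matrix and the input matrix repeats \<open>B\<close>,
  so every block of a stacked vector evolves alike. Stacked vectors thus form an invariant subspace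
  of the large system, on which it acts as the small closed loop.\<close>

lemma stack_vec_closed_loop:
  fixes B :: "real ^ 'm ^ 'n" and P :: "real ^ ('N::finite \<times> 'n) ^ ('N \<times> 'n)"
  shows "stack_vec (closed_loop_matrix \<alpha> M B P *v x)
    = (block_diag (\<lambda>_::'N. M) - (1 / \<alpha>) *\<^sub>R (stack_matrix B ** transpose (stack_matrix B) ** P))
        *v stack_vec x"
proof -
  have "matrix stack_vec *v x = (stack_vec x :: real ^ ('N \<times> 'n))"
    using linear_stack_vec by (intro matrix_works) (simp add: scalar_mult_eq_scaleR[abs_def] linear_def)
  then show ?thesis
    by (simp add: closed_loop_matrix_def matrix_vector_mult_diff_rdistrib
        scaleR_matrix_vector_assoc[symmetric] matrix_vector_mul_assoc[symmetric]
        linear_diff[OF linear_stack_vec] linear_scale[OF linear_stack_vec]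
        block_diag_mult_stack_vec stack_matrix_mult)
qed

section \<open>Lyapunov forms: spectral stability and exponential decay\<close>

lemma stable_matrix_Lyapunov:
  fixes G :: "real ^ 'k ^ 'k" and b :: "real ^ 'k \<Rightarrow> real ^ 'k \<Rightarrow> real"
  assumes "bilinear b" and sym: "\<And>x y. b x y = b y x" and pos: "\<And>x. x \<noteq> 0 \<Longrightarrow> 0 < b x x"
    and "r > 0" and decay: "\<And>x. 2 * b x (G *v x) \<le> - r * b x x"
  shows "stable_matrix G"
  unfolding stable_matrix_def eigenvalue_def
proof (intro allI impI, elim exE conjE)
  fix \<mu> and v :: "complex ^ 'k"
  assume "v \<noteq> 0" and ev: "map_matrix complex_of_real G *v v = \<mu> *s v"
  define p q where "p = (\<chi> i. Re (v $ i))" and "q = (\<chi> i. Im (v $ i))"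
  have ev_i: "(\<Sum>j\<in>UNIV. complex_of_real (G $ i $ j) * v $ j) = \<mu> * v $ i" for i
    using ev by (simp add: vec_eq_iff matrix_vector_mult_def map_matrix_def)
  have Gp: "G *v p = Re \<mu> *\<^sub>R p - Im \<mu> *\<^sub>R q"
    using arg_cong[OF ev_i, of Re]
    by (simp add: vec_eq_iff matrix_vector_mult_def p_def q_def)
  have Gq: "G *v q = Im \<mu> *\<^sub>R p + Re \<mu> *\<^sub>R q"
    using arg_cong[OF ev_i, of Im]
    by (simp add: vec_eq_iff matrix_vector_mult_def p_def q_def)
  have nonneg: "0 \<le> b x x" for x
    using pos[of x] bilinear_lzero[OF \<open>bilinear b\<close>] by (cases "x = 0") (auto simp: less_imp_le)
  have "p \<noteq> 0 \<or> q \<noteq> 0"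
    using \<open>v \<noteq> 0\<close> by (auto simp: vec_eq_iff p_def q_def complex_eq_iff)
  then have pos_pq: "0 < b p p + b q q"
    using pos nonneg by (meson add_nonneg_pos add_pos_nonneg)
  \<comment> \<open>The cross terms carry \<open>Im \<mu>\<close> with opposite signs and cancel by
    the symmetry of \<open>b\<close>. This is why the real and imaginary parts are added.\<close>
  have "b p (G *v p) + b q (G *v q) = Re \<mu> * (b p p + b q q)"
    using \<open>bilinear b\<close>
    by (simp add: Gp Gq bilinear_radd bilinear_rsub bilinear_rmul sym[of q p] algebra_simps)
  then have "2 * Re \<mu> * (b p p + b q q) \<le> - r * (b p p + b q q)"
    using decay[of p] decay[of q] by (simp add: algebra_simps)
  then have "2 * Re \<mu> \<le> - r"
    using pos_pq by (simp only: mult_le_cancel_right_pos)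
  then show "Re \<mu> < 0"
    using \<open>r > 0\<close> by simp
qed

lemma exponential_decay:
  fixes V V' :: "real \<Rightarrow> real"
  assumes der: "\<And>t. t \<ge> 0 \<Longrightarrow> (V has_real_derivative V' t) (at t within {0..})"
    and le: "\<And>t. t \<ge> 0 \<Longrightarrow> V' t \<le> - r * V t" and "t \<ge> 0"
  shows "V t \<le> exp (- r * t) * V 0"
proof -
  \<comment> \<open>The integrating factor turns the differential inequality into monotonicity:
    \<open>f\<close> has nonpositive derivative.\<close>
  define f where "f = (\<lambda>s. exp (r * s) * V s)"
  have f_der: "(f has_real_derivative exp (r * s) * (V' s + r * V s)) (at s within {0..})"
    if "s \<ge> 0" for s
    unfolding f_def by (rule derivative_eq_intros der[OF that] refl | simp add: algebra_simps)+
  have "f t \<le> f 0"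
  \<comment> \<open>At 0 only a one-sided derivative is given. The sign is therefore checked at
    interior points, and the endpoints are covered by continuity.\<close>
  proof (rule DERIV_nonpos_imp_decreasing_open[OF \<open>t \<ge> 0\<close>])
    fix s assume "0 < s" "s < t"
    then have "at s within {0..} = at s"
      by (intro at_within_interior) simp
    then show "\<exists>y. (f has_real_derivative y) (at s) \<and> y \<le> 0"
      using f_der[of s] le[of s] \<open>0 < s\<close>
      by (intro exI[of _ "exp (r * s) * (V' s + r * V s)"]) (simp add: mult_le_0_iff)
  next
    show "continuous_on {0..t} f"
      by (rule continuous_on_subset[OF DERIV_continuous_on[OF f_der]]) auto
  qed
  then show ?thesis
    by (simp add: f_def exp_minus field_simps)
qed

section \<open>Stability and decay estimates of the ensemble feedback\<close>

theorem corollary3p9: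
  fixes A :: "real \<Rightarrow> real ^ 'n ^ 'n"
    and B :: "real ^ 'm ^ 'n"
    and \<Sigma> :: "'N::finite \<Rightarrow> real"
    and \<sigma> \<alpha> \<beta>\<^sub>1 \<beta>\<^sub>2 :: real
    and x\<^sub>0 :: "real ^ 'n"
    and P :: "real ^ ('N \<times> 'n) ^ ('N \<times> 'n)"
  assumes "CARD('N) \<ge> 2"
    and "\<alpha> > 0"
    and "ensemble_stabilizable (\<lambda>i. A (\<Sigma> i)) B"
    and "pos_def P"
    and "riccati_solution \<alpha> (\<lambda>i. A (\<Sigma> i)) B P"
    and "\<beta>\<^sub>1 > 0" and "\<beta>\<^sub>2 > 0"
    and "\<And>y. \<beta>\<^sub>1 * norm y \<le> weighted_norm P y"
    and "\<And>y. weighted_norm P y \<le> \<beta>\<^sub>2 * norm y"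
    and "matrix_opnorm (block_diag (\<lambda>_::'N. A \<sigma>) - block_diag (\<lambda>i. A (\<Sigma> i)))
           < \<beta>\<^sub>1 / (2 * real CARD('N) * \<beta>\<^sub>2 ^ 3)"
  shows "let G = closed_loop_matrix \<alpha> (A \<sigma>) B P;
             rate = 1 / (real CARD('N) * \<beta>\<^sub>2\<^sup>2) - 2 * \<beta>\<^sub>2 / \<beta>\<^sub>1
                      * matrix_opnorm (block_diag (\<lambda>_::'N. A \<sigma>) - block_diag (\<lambda>i. A (\<Sigma> i)))
         in stable_matrix G \<and> rate > 0 \<and>
            (\<forall>x :: real \<Rightarrow> real ^ 'n.
               x 0 = x\<^sub>0 \<and>
               (\<forall>t\<ge>0. (x has_vector_derivative G *v x t) (at t within {0..})) \<longrightarrow>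
               (\<forall>t\<ge>0.
                  (weighted_norm P (stack_vec (x t)))\<^sup>2
                    \<le> exp (- rate * t) * (weighted_norm P (stack_vec (x 0)))\<^sup>2 \<and>
                  (norm (x t))\<^sup>2 \<le> (\<beta>\<^sub>2 / \<beta>\<^sub>1)\<^sup>2 * exp (- rate * t) * (norm (x 0))\<^sup>2))"
proof -
  let ?E = "stack_vec :: real ^ 'n \<Rightarrow> real ^ ('N \<times> 'n)"
  let ?S = "block_diag (\<lambda>i. A (\<Sigma> i))"
  let ?\<Delta> = "block_diag (\<lambda>_::'N. A \<sigma>) - ?S"
  define G where "G = closed_loop_matrix \<alpha> (A \<sigma>) B P"
  define rate where "rate = 1 / (real CARD('N) * \<beta>\<^sub>2\<^sup>2) - 2 * \<beta>\<^sub>2 / \<beta>\<^sub>1 * matrix_opnorm ?\<Delta>"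
  \<comment> \<open>This is the form of \<open>P\<close> pulled back along the stacking map. It
    serves as the Lyapunov form of \<open>G\<close> on the small space.\<close>
  define b where "b = (\<lambda>x y. ?E x \<bullet> (P *v ?E y))"
  note lower = assms(8) and upper = assms(9)

  have b_wn: "b x x = (weighted_norm P (?E x))\<^sup>2" for x
    by (simp add: b_def weighted_norm_power2[OF \<open>pos_def P\<close>])
  have b_bilinear: "bilinear b"
    unfolding b_def bilinear_def
    by (auto intro!: linearI simp: inner_add_left inner_add_right
        linear_add[OF linear_stack_vec] linear_scale[OF linear_stack_vec]
        matrix_vector_right_distrib matrix_vector_mult_scaleR)
  have b_sym: "b x y = b y x" for x y
    unfolding b_def by (rule pos_def_inner_commute[OF \<open>pos_def P\<close>])
  have b_lower: "\<beta>\<^sub>1\<^sup>2 * (real CARD('N) * (norm x)\<^sup>2) \<le> b x x" for x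
    using power_mono[OF lower[of "?E x"], of 2] \<open>\<beta>\<^sub>1 > 0\<close>
    by (simp add: b_wn power_mult_distrib norm_stack_vec)
  have b_upper: "b x x \<le> \<beta>\<^sub>2\<^sup>2 * (real CARD('N) * (norm x)\<^sup>2)" for x
  proof -
    have "0 \<le> weighted_norm P (?E x)"
      using lower[of "?E x"] \<open>\<beta>\<^sub>1 > 0\<close> by (meson dual_order.trans less_imp_le mult_nonneg_nonneg norm_ge_zero)
    then show ?thesis
      using power_mono[OF upper[of "?E x"], of 2]
      by (simp add: b_wn power_mult_distrib norm_stack_vec)
  qed
  have b_pos: "0 < b x x" if "x \<noteq> 0" for x
    using that \<open>\<beta>\<^sub>1 > 0\<close> by (intro less_le_trans[OF _ b_lower]) simp

  \<comment> \<open>The smallness hypothesis is scaled so that its threshold becomes exactly the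
    unperturbed decay rate.\<close>
  have "2 * \<beta>\<^sub>2 / \<beta>\<^sub>1 * matrix_opnorm ?\<Delta>
      < 2 * \<beta>\<^sub>2 / \<beta>\<^sub>1 * (\<beta>\<^sub>1 / (2 * real CARD('N) * \<beta>\<^sub>2 ^ 3))"
    using assms(6,7,10) by (intro mult_strict_left_mono) simp_all
  also have "\<dots> = 1 / (real CARD('N) * \<beta>\<^sub>2\<^sup>2)"
    using assms(6,7) by (simp add: field_simps power2_eq_square power3_eq_cube)
  finally have rate_pos: "rate > 0"
    by (simp add: rate_def)

  have decay: "2 * b x (G *v x) \<le> - rate * b x x" for x
  proof -
    \<comment> \<open>Writing the identical-block matrix as \<open>?S + ?\<Delta>\<close> exposes
      \<open>?S\<close>, the matrix for which \<open>P\<close> solves the Riccati equation.\<close>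
    have "?E (G *v x) = (?S + ?\<Delta>
        - (1 / \<alpha>) *\<^sub>R (stack_matrix B ** transpose (stack_matrix B) ** P)) *v ?E x"
      unfolding G_def by (simp add: stack_vec_closed_loop)
    then show ?thesis
      using riccati_dissipation[OF \<open>pos_def P\<close> \<open>\<alpha> > 0\<close> _ assms(5)[unfolded riccati_solution_def]
          \<open>\<beta>\<^sub>1 > 0\<close> \<open>\<beta>\<^sub>2 > 0\<close> lower upper, of "?E x" ?\<Delta>]
      by (simp add: b_wn rate_def) (simp add: b_def)
  qed

  have "stable_matrix G"
    by (rule stable_matrix_Lyapunov[OF b_bilinear b_sym b_pos rate_pos decay])
  moreover have "b (x t) (x t) \<le> exp (- rate * t) * b (x 0) (x 0)
      \<and> (norm (x t))\<^sup>2 \<le> (\<beta>\<^sub>2 / \<beta>\<^sub>1)\<^sup>2 * exp (- rate * t) * (norm (x 0))\<^sup>2"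
    if ode: "\<forall>t\<ge>0. (x has_vector_derivative G *v x t) (at t within {0..})" and "t \<ge> 0"
    for x :: "real \<Rightarrow> real ^ 'n" and t
  proof -
    have "((\<lambda>t. b (x t) (x t)) has_real_derivative 2 * b (x s) (G *v x s)) (at s within {0..})"
      if "s \<ge> 0" for s
    proof -
      have "bounded_bilinear b"
        using b_bilinear by (simp add: bilinear_conv_bounded_bilinear)
      from bounded_bilinear.has_vector_derivative[OF this] ode that
      have "((\<lambda>t. b (x t) (x t)) has_vector_derivative b (x s) (G *v x s) + b (G *v x s) (x s))
          (at s within {0..})"
        by blast
      then show ?thesis
        by (simp add: has_real_derivative_iff_has_vector_derivative b_sym[of "G *v x s"])
    qed
    then have *: "b (x t) (x t) \<le> exp (- rate * t) * b (x 0) (x 0)"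
      by (rule exponential_decay) (use decay \<open>t \<ge> 0\<close> in auto)
    have "\<beta>\<^sub>1\<^sup>2 * (real CARD('N) * (norm (x t))\<^sup>2) \<le> b (x t) (x t)"
      by (rule b_lower)
    also note *
    also have "exp (- rate * t) * b (x 0) (x 0)
        \<le> exp (- rate * t) * (\<beta>\<^sub>2\<^sup>2 * (real CARD('N) * (norm (x 0))\<^sup>2))"
      by (intro mult_left_mono b_upper) simp
    \<comment> \<open>Stacking multiplies the squared norm by N on both sides. This factor cancels,
      so only the ratio of the two norm constants remains in the estimate.\<close>
    finally have "real CARD('N) * (\<beta>\<^sub>1\<^sup>2 * (norm (x t))\<^sup>2)
        \<le> real CARD('N) * (exp (- rate * t) * (\<beta>\<^sub>2\<^sup>2 * (norm (x 0))\<^sup>2))"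
      by (simp only: mult_ac)
    then have "\<beta>\<^sub>1\<^sup>2 * (norm (x t))\<^sup>2 \<le> exp (- rate * t) * (\<beta>\<^sub>2\<^sup>2 * (norm (x 0))\<^sup>2)"
      by simp
    then have "(norm (x t))\<^sup>2 \<le> exp (- rate * t) * (\<beta>\<^sub>2\<^sup>2 * (norm (x 0))\<^sup>2) / \<beta>\<^sub>1\<^sup>2"
      using \<open>\<beta>\<^sub>1 > 0\<close> by (simp add: le_divide_eq mult.commute)
    then show ?thesis
      using * by (simp add: power_divide mult_ac)
  qed
  ultimately show ?thesis
    unfolding Let_def G_def[symmetric] rate_def[symmetric] b_wn[symmetric] using rate_pos by blast
qed

end
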